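(* The plane curve over $\mathbb{C}$ $$\{[X:Y:Z]\in\mathbb{P}^2 : X(Y^5+Z^5)+(XYZ)^2-X^4YZ-2(YZ)^3=0\}$$ (the HC-model) is a model of Bring's curve $$\mathcal{B}=\Big\{[x_1:x_2:x_3:x_4:x_5]\in\mathbb{P}^4 : \sum_{i=1}^5 x_i=\sum_{i=1}^5x_i^2=\sum_{i=1}^5x_i^3=0\Big\},$$ i.e. the two curves are birationally equivalent over $\mathbb{C}$.
   Context: All projective spaces are over $\mathbb{C}$. The plane curve is singular; $\mathcal{B}\subset\mathbb{P}^4$ is a smooth curve of genus $4$. "Is a model of" means birationally equivalent. *)

theory Defs
  imports "HOL-Analysis.Analysis"
begin

text \<open>
  The type \<open>'n cproj\<close> is the complex projective space of dimension \<open>CARD('n) - 1\<close>: nonzero vectors of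
  \<open>complex ^ 'n\<close> modulo scaling. For \<open>x \<noteq> 0\<close>, \<open>proj_pt x\<close> is the point with homogeneous
  coordinates \<open>x\<close>; the value \<open>proj_pt 0\<close> has no meaning.
\<close>

definition proj_rel :: "complex ^ 'n::finite \<Rightarrow> complex ^ 'n \<Rightarrow> bool" where
  "proj_rel x y \<longleftrightarrow> x \<noteq> 0 \<and> y \<noteq> 0 \<and> (\<exists>c. c \<noteq> 0 \<and> y = c *s x)"

lemma part_equivp_proj_rel: "part_equivp (proj_rel :: complex ^ 'n::finite \<Rightarrow> _)"
proof (rule part_equivpI)
  have "proj_rel (1 :: complex ^ 'n) 1"
    unfolding proj_rel_def by (auto intro!: exI[of _ 1])
  then show "\<exists>x :: complex ^ 'n. proj_rel x x" ..
  show "symp (proj_rel :: complex ^ 'n \<Rightarrow> _)"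
  proof (rule sympI)
    fix x y :: "complex ^ 'n"
    assume "proj_rel x y"
    then obtain c where "x \<noteq> 0" "y \<noteq> 0" "c \<noteq> 0" "y = c *s x"
      by (auto simp: proj_rel_def)
    then show "proj_rel y x"
      unfolding proj_rel_def by (auto intro!: exI[of _ "inverse c"])
  qed
  show "transp (proj_rel :: complex ^ 'n \<Rightarrow> _)"
  proof (rule transpI)
    fix x y z :: "complex ^ 'n"
    assume "proj_rel x y" "proj_rel y z"
    then obtain c d where "x \<noteq> 0" "z \<noteq> 0" "c \<noteq> 0" "y = c *s x" "d \<noteq> 0" "z = d *s y"
      by (auto simp: proj_rel_def)
    then show "proj_rel x z"
      unfolding proj_rel_def by (auto intro!: exI[of _ "d * c"])
  qed
qed

quotient_type (overloaded) 'n cproj = "complex ^ 'n::finite" / partial: proj_rel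
  morphisms homog_coords proj_pt
  by (rule part_equivp_proj_rel)

lemma proj_pt_eq_iff:
  assumes "x \<noteq> 0" "y \<noteq> 0"
  shows "proj_pt x = proj_pt y \<longleftrightarrow> (\<exists>c. c \<noteq> 0 \<and> y = c *s x)"
proof -
  have "proj_rel x x" "proj_rel y y"
    using assms unfolding proj_rel_def by (auto intro!: exI[of _ 1])
  then have "proj_pt x = proj_pt y \<longleftrightarrow> proj_rel x y"
    using Quotient3_rel[OF Quotient3_cproj] by blast
  then show ?thesis
    using assms by (simp add: proj_rel_def)
qed

text \<open>
  Homogeneous polynomials are represented by the functions they induce, which loses nothing over
  an infinite field. The function \<open>m\<close> is the exponent vector of a monomial.
\<close>

definition homogeneous_poly :: "nat \<Rightarrow> (complex ^ 'n::finite \<Rightarrow> complex) \<Rightarrow> bool" where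
  "homogeneous_poly d F \<longleftrightarrow>
     (\<exists>(M :: ('n \<Rightarrow> nat) set) c. finite M \<and> (\<forall>m\<in>M. (\<Sum>i\<in>UNIV. m i) = d) \<and>
        F = (\<lambda>x. \<Sum>m\<in>M. c m * (\<Prod>i\<in>UNIV. (x $ i) ^ m i)))"

text \<open>
  The sets \<open>D(F) = {F \<noteq> 0}\<close> are closed under binary intersection, so they form a base of the
  topology they generate; its closed sets are the common zero loci of homogeneous polynomials.
\<close>

definition zariski :: "'n::finite cproj topology" where
  "zariski = topology_generated_by
     {{proj_pt x | x. x \<noteq> 0 \<and> F x \<noteq> 0} | F. \<exists>d. homogeneous_poly d F}"

definition dense_open_in :: "'n::finite cproj set \<Rightarrow> 'n cproj set \<Rightarrow> bool" where
  "dense_open_in X U \<longleftrightarrow>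
     openin (subtopology zariski X) U \<and> (subtopology zariski X) closure_of U = X"

text \<open>
  A regular map is given Zariski-locally on its domain by homogeneous polynomials of one common
  degree without common zero there.
\<close>

definition regular_map_on ::
    "'n::finite cproj set \<Rightarrow> ('n cproj \<Rightarrow> 'm::finite cproj) \<Rightarrow> bool" where
  "regular_map_on U \<phi> \<longleftrightarrow>
     (\<forall>p\<in>U. \<exists>W d (F :: complex ^ 'n \<Rightarrow> complex ^ 'm).
        openin (subtopology zariski U) W \<and> p \<in> W \<and>
        (\<forall>i. homogeneous_poly d (\<lambda>x. F x $ i)) \<and>
        (\<forall>x. x \<noteq> 0 \<longrightarrow> proj_pt x \<in> W \<longrightarrow> F x \<noteq> 0 \<and> \<phi> (proj_pt x) = proj_pt (F x)))"

text \<open>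
  A rational map \<open>X \<dashrightarrow> Y\<close> is represented by a pair \<open>(U, \<phi>)\<close>; the values of \<open>\<phi>\<close>
  outside \<open>U\<close> are irrelevant.
\<close>

definition rational_map ::
    "'n::finite cproj set \<Rightarrow> 'm::finite cproj set \<Rightarrow> 'n cproj set \<Rightarrow> ('n cproj \<Rightarrow> 'm cproj) \<Rightarrow> bool"
where
  "rational_map X Y U \<phi> \<longleftrightarrow> dense_open_in X U \<and> regular_map_on U \<phi> \<and> \<phi> ` U \<subseteq> Y"

text \<open>
  Birational equivalence: mutually inverse rational maps. The composite of \<open>(U, \<phi>)\<close> with
  \<open>(V, \<psi>)\<close> is defined on \<open>{p \<in> U. \<phi> p \<in> V}\<close>; requiring this set to be dense makes
  the two rational maps composable, also when \<open>X\<close> or \<open>Y\<close> is reducible. For irreducible \<open>X\<close>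
  and \<open>Y\<close> it is automatic for dominant maps.
\<close>

definition birationally_equivalent ::
    "'n::finite cproj set \<Rightarrow> 'm::finite cproj set \<Rightarrow> bool" where
  "birationally_equivalent X Y \<longleftrightarrow>
     (\<exists>U \<phi> V \<psi>. rational_map X Y U \<phi> \<and> rational_map Y X V \<psi> \<and>
        dense_open_in X {p \<in> U. \<phi> p \<in> V} \<and> (\<forall>p\<in>U. \<phi> p \<in> V \<longrightarrow> \<psi> (\<phi> p) = p) \<and>
        dense_open_in Y {q \<in> V. \<psi> q \<in> U} \<and> (\<forall>q\<in>V. \<psi> q \<in> U \<longrightarrow> \<phi> (\<psi> q) = q))"

definition HC_curve :: "3 cproj set" where
  "HC_curve = {proj_pt v | v. v \<noteq> 0 \<and>
     (let X = v $ 1; Y = v $ 2; Z = v $ 3 in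
        X * (Y ^ 5 + Z ^ 5) + (X * Y * Z) ^ 2 - X ^ 4 * Y * Z - 2 * (Y * Z) ^ 3 = 0)}"

definition Bring_curve :: "5 cproj set" where
  "Bring_curve = {proj_pt x | x. x \<noteq> 0 \<and>
     (\<Sum>i\<in>UNIV. x $ i) = 0 \<and> (\<Sum>i\<in>UNIV. (x $ i) ^ 2) = 0 \<and> (\<Sum>i\<in>UNIV. (x $ i) ^ 3) = 0}"

end

theory Submission
  imports Defs "HOL-Computational_Algebra.Fundamental_Theorem_Algebra"
begin

text \<open>
  The plane sextic has six nodes, at \<open>[1:0:0]\<close> and at \<open>[1 : \<zeta> : 1/\<zeta>]\<close> with \<open>\<zeta> ^ 5 = 1\<close>. Blowing up
  these six points of the plane gives a cubic surface, the Clebsch surface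
  \<open>\<Sum> x\<^sub>i = \<Sum> x\<^sub>i\<^sup>3 = 0\<close>, embedded by the four-dimensional space of cubics through the points:
  \<open>a = Y (X\<^sup>2 - Y Z)\<close>, \<open>b = X Y\<^sup>2 - Z\<^sup>3\<close>, \<open>c = X Z\<^sup>2 - Y\<^sup>3\<close>, \<open>d = Z (X\<^sup>2 - Y Z)\<close>.
  Sextics with nodes at the six points correspond to quadric sections of the surface. Bring's curve
  is the section by \<open>\<Sum> x\<^sub>i\<^sup>2 = 0\<close>, and the sextic that belongs to it is the HC-model.

  All of this is made explicit. The four cubics are eigenvectors of
  \<open>(X, Y, Z) \<mapsto> (X, \<zeta> Y, Z / \<zeta>)\<close>, so they are compared with the coordinates on the hyperplane
  \<open>\<Sum> x\<^sub>i = 0\<close> that diagonalise a cyclic permutation of the \<open>x\<^sub>i\<close>. In these coordinates Bring's curve has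
  the equations \<open>a d + b c = 0\<close> and \<open>a\<^sup>2 c - b d\<^sup>2 + a b\<^sup>2 - c\<^sup>2 d = 0\<close>
  (\<open>on_bring_vec_of_fourier\<close>). The cubics satisfy the second equation identically, and
  \<open>a d + b c\<close> is minus the sextic form (\<open>on_bring_to_bring\<close>). The inverse map
  \<open>[a\<^sup>2 - c d : a b : b d]\<close> comes from the linear syzygies of the cubics
  (\<open>to_hc_to_bring\<close>, \<open>to_hc_inverse\<close>). The two maps are inverse bijections between the
  complements of finitely many points on each curve.

  It remains to see that these complements are Zariski dense. It suffices that every point of
  either curve is a limit, in the classical topology, of points of the complement
  (\<open>dense_open_inI\<close>). Each curve is cut by a pencil of lines into finite sets: lines through a
  point off the curve for the sextic, one ruling of the quadric \<open>a d + b c = 0\<close> for Bring's curve. The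
  roots of a polynomial depend continuously on its coefficients (\<open>roots_tendsto_0\<close>),
  so moving the line slightly, away from the finitely many lines through excluded points, moves
  the point slightly along the curve (\<open>hc_approx\<close>, \<open>bring_approx\<close>).
\<close>

section \<open>Homogeneous forms\<close>

lemma homogeneous_poly_coord: "homogeneous_poly 1 (\<lambda>x. x $ i)"
  unfolding homogeneous_poly_def
proof (intro exI conjI)
  show "finite {\<lambda>j. if j = i then 1 else (0::nat)}" by simp
  show "\<forall>m\<in>{\<lambda>j. if j = i then 1 else (0::nat)}. (\<Sum>j\<in>UNIV. m j) = 1" by simp
  have "(\<Prod>j\<in>UNIV. (x $ j) ^ (if j = i then 1 else 0)) = x $ i" for x :: "complex ^ 'a"
    by (subst prod.remove[of _ i]) auto
  then show "(\<lambda>x. x $ i) = (\<lambda>x::complex ^ 'a. \<Sum>m\<in>{\<lambda>j. if j = i then 1 else (0::nat)}.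
      (\<lambda>_. 1) m * (\<Prod>j\<in>UNIV. (x $ j) ^ m j))"
    by simp
qed

lemma homogeneous_poly_const: "homogeneous_poly 0 (\<lambda>x. a)"
  unfolding homogeneous_poly_def
  by (intro exI[of _ "{\<lambda>_. 0}"] exI[of _ "\<lambda>_. a"]) auto

lemma homogeneous_poly_add:
  assumes "homogeneous_poly d F" "homogeneous_poly e G" "d = e"
  shows "homogeneous_poly d (\<lambda>x. F x + G x)"
proof -
  obtain M c where M: "finite M" "\<forall>m\<in>M. (\<Sum>i\<in>UNIV. m i) = d"
    and F: "F = (\<lambda>x. \<Sum>m\<in>M. c m * (\<Prod>i\<in>UNIV. (x $ i) ^ m i))"
    using assms(1) unfolding homogeneous_poly_def by blast
  obtain N c' where N: "finite N" "\<forall>m\<in>N. (\<Sum>i\<in>UNIV. m i) = d"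
    and G: "G = (\<lambda>x. \<Sum>m\<in>N. c' m * (\<Prod>i\<in>UNIV. (x $ i) ^ m i))"
    using assms(2,3) unfolding homogeneous_poly_def by blast
  define k where "k m = (if m \<in> M then c m else 0) + (if m \<in> N then c' m else 0)" for m
  have "F x + G x = (\<Sum>m\<in>M \<union> N. k m * (\<Prod>i\<in>UNIV. (x $ i) ^ m i))" for x
  proof -
    have "F x = (\<Sum>m\<in>M \<union> N. (if m \<in> M then c m else 0) * (\<Prod>i\<in>UNIV. (x $ i) ^ m i))"
      unfolding F using M N by (intro sum.mono_neutral_cong_left) auto
    moreover have "G x = (\<Sum>m\<in>M \<union> N. (if m \<in> N then c' m else 0) * (\<Prod>i\<in>UNIV. (x $ i) ^ m i))"
      unfolding G using M N by (intro sum.mono_neutral_cong_left) auto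
    ultimately show ?thesis
      by (simp only: k_def distrib_right sum.distrib)
  qed
  then show ?thesis
    unfolding homogeneous_poly_def using M N
    by (intro exI[of _ "M \<union> N"] exI[of _ k]) auto
qed

lemma homogeneous_poly_mult:
  fixes F G :: "complex ^ 'a::finite \<Rightarrow> complex"
  assumes "homogeneous_poly d F" "homogeneous_poly d' G"
  shows "homogeneous_poly (d + d') (\<lambda>x. F x * G x)"
proof -
  obtain M c where M: "finite M" "\<forall>m\<in>M. (\<Sum>i\<in>UNIV. m i) = d"
    and F: "F = (\<lambda>x. \<Sum>m\<in>M. c m * (\<Prod>i\<in>UNIV. (x $ i) ^ m i))"
    using assms(1) unfolding homogeneous_poly_def by blast
  obtain N e where N: "finite N" "\<forall>m\<in>N. (\<Sum>i\<in>UNIV. m i) = d'"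
    and G: "G = (\<lambda>x. \<Sum>m\<in>N. e m * (\<Prod>i\<in>UNIV. (x $ i) ^ m i))"
    using assms(2) unfolding homogeneous_poly_def by blast
  define h where "h = (\<lambda>(m :: 'a \<Rightarrow> nat, n) i. m i + n i)"
  define k where "k r = (\<Sum>p | p \<in> M \<times> N \<and> h p = r. c (fst p) * e (snd p))" for r
  have "F x * G x = (\<Sum>r\<in>h ` (M \<times> N). k r * (\<Prod>i\<in>UNIV. (x $ i) ^ r i))" for x
  proof -
    \<comment> \<open>Different pairs of monomials may have the same product, so the terms are grouped by exponent.\<close>
    have "F x * G x = (\<Sum>p\<in>M \<times> N. c (fst p) * e (snd p) * (\<Prod>i\<in>UNIV. (x $ i) ^ h p i))"
      unfolding F G sum_product sum.cartesian_product
      by (intro sum.cong) (auto simp: h_def power_add prod.distrib)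
    also have "\<dots> = (\<Sum>r\<in>h ` (M \<times> N). \<Sum>p | p \<in> M \<times> N \<and> h p = r.
        c (fst p) * e (snd p) * (\<Prod>i\<in>UNIV. (x $ i) ^ h p i))"
      using M N by (intro sum.image_gen) auto
    also have "\<dots> = (\<Sum>r\<in>h ` (M \<times> N). k r * (\<Prod>i\<in>UNIV. (x $ i) ^ r i))"
      unfolding k_def sum_distrib_right by (intro sum.cong) auto
    finally show ?thesis .
  qed
  moreover have "\<forall>r\<in>h ` (M \<times> N). (\<Sum>i\<in>UNIV. r i) = d + d'"
    using M N by (auto simp: h_def sum.distrib)
  ultimately show ?thesis
    unfolding homogeneous_poly_def using M N
    by (intro exI[of _ "h ` (M \<times> N)"] exI[of _ k]) auto
qed

lemma homogeneous_poly_minus: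
  "homogeneous_poly d F \<Longrightarrow> homogeneous_poly d (\<lambda>x. - F x)"
  using homogeneous_poly_mult[OF homogeneous_poly_const, of d F "-1"] by simp

lemma homogeneous_poly_diff:
  assumes "homogeneous_poly d F" "homogeneous_poly e G" "d = e"
  shows "homogeneous_poly d (\<lambda>x. F x - G x)"
  using homogeneous_poly_add[OF assms(1) homogeneous_poly_minus[OF assms(2)] assms(3)] by simp

lemma homogeneous_poly_power:
  assumes "homogeneous_poly d F"
  shows "homogeneous_poly (k * d) (\<lambda>x. F x ^ k)"
proof (induction k)
  case 0
  show ?case using homogeneous_poly_const[of 1] by simp
next
  case (Suc k)
  show ?case using homogeneous_poly_mult[OF assms Suc.IH] by simp
qed

lemma homogeneous_poly_sum:
  assumes "finite A" "\<And>j. j \<in> A \<Longrightarrow> homogeneous_poly d (\<lambda>x. F j x)"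
  shows "homogeneous_poly d (\<lambda>x. \<Sum>j\<in>A. F j x)"
  using assms
proof (induction A rule: finite_induct)
  case empty
  have "homogeneous_poly d (\<lambda>x::complex^'b. 0)"
    unfolding homogeneous_poly_def by (intro exI[of _ "{}"]) auto
  then show ?case by simp
next
  case (insert j A)
  then show ?case using homogeneous_poly_add[of d "F j" d "\<lambda>x. \<Sum>j\<in>A. F j x"] by simp
qed

text \<open>
  With the degrees of summands matched by a separate equation, resolution with these rules
  computes the degree of a form; \<open>homogeneous_poly_degree_eq\<close> compares it with the expected one.
\<close>

lemmas homogeneous_poly_intros = homogeneous_poly_add homogeneous_poly_diff homogeneous_poly_minus
  homogeneous_poly_mult homogeneous_poly_power homogeneous_poly_const homogeneous_poly_coord

lemma homogeneous_poly_degree_eq: "homogeneous_poly d F \<Longrightarrow> d = e \<Longrightarrow> homogeneous_poly e F"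
  by simp

lemma homogeneous_poly_scale:
  assumes "homogeneous_poly d F"
  shows "F (c *s x) = c ^ d * F x"
proof -
  obtain M k where M: "\<forall>m\<in>M. (\<Sum>i\<in>UNIV. m i) = d"
    and F: "F = (\<lambda>x. \<Sum>m\<in>M. k m * (\<Prod>i\<in>UNIV. (x $ i) ^ m i))"
    using assms unfolding homogeneous_poly_def by blast
  have "k m * (\<Prod>i\<in>UNIV. ((c *s x) $ i) ^ m i) = c ^ d * (k m * (\<Prod>i\<in>UNIV. (x $ i) ^ m i))"
    if "m \<in> M" for m
  proof -
    have "(\<Prod>i\<in>UNIV. c ^ m i) = c ^ d"
      using M that by (simp flip: power_sum)
    then show ?thesis
      by (simp add: power_mult_distrib prod.distrib)
  qed
  then show ?thesis
    unfolding F sum_distrib_left by (intro sum.cong) auto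
qed

lemma homogeneous_poly_isCont:
  assumes "homogeneous_poly d F"
  shows "isCont F x"
proof -
  obtain M k where F: "F = (\<lambda>x. \<Sum>m\<in>M. k m * (\<Prod>i\<in>UNIV. (x $ i) ^ m i))"
    using assms unfolding homogeneous_poly_def by blast
  show ?thesis unfolding F by (intro continuous_intros)
qed

lemma homogeneous_poly_nonzero_proj_pt:
  assumes "homogeneous_poly d F" "x \<noteq> 0" "y \<noteq> 0" "proj_pt x = proj_pt y" "F x \<noteq> 0"
  shows "F y \<noteq> 0"
proof -
  obtain c where "c \<noteq> 0" "y = c *s x"
    using assms proj_pt_eq_iff by metis
  then show ?thesis using homogeneous_poly_scale[OF assms(1)] assms(5) by simp
qed

lemma homog_coords_proj_pt:
  assumes "x \<noteq> 0"
  obtains c where "c \<noteq> 0" "homog_coords (proj_pt x) = c *s x"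
proof -
  have "proj_rel x x"
    using assms unfolding proj_rel_def by (auto intro!: exI[of _ 1])
  then have "proj_rel x (homog_coords (proj_pt x))"
    by (metis Quotient3_rep_abs[OF Quotient3_cproj] part_equivp_symp[OF part_equivp_proj_rel])
  then show thesis using that unfolding proj_rel_def by blast
qed

section \<open>The Zariski topology and density\<close>

definition basic_open :: "(complex ^ 'n::finite \<Rightarrow> complex) \<Rightarrow> 'n cproj set" where
  "basic_open F = {proj_pt x | x. x \<noteq> 0 \<and> F x \<noteq> 0}"

lemma openin_basic_open: "homogeneous_poly d F \<Longrightarrow> openin zariski (basic_open F)"
  unfolding zariski_def basic_open_def by (rule topology_generated_by_Basis) blast

lemma proj_pt_in_basic_open_iff:
  assumes "homogeneous_poly d F" "x \<noteq> 0"
  shows "proj_pt x \<in> basic_open F \<longleftrightarrow> F x \<noteq> 0"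
proof
  assume "proj_pt x \<in> basic_open F"
  then obtain y where "y \<noteq> 0" "F y \<noteq> 0" "proj_pt x = proj_pt y"
    unfolding basic_open_def by blast
  then show "F x \<noteq> 0" using homogeneous_poly_nonzero_proj_pt[OF assms(1)] assms(2) by metis
qed (use assms(2) basic_open_def in blast)

text \<open>
  The sets \<open>D(F) = {F \<noteq> 0}\<close> were introduced as a subbase; they form a base because
  \<open>D(F) \<inter> D(G) = D(F G)\<close>.
\<close>

lemma zariski_base:
  assumes "openin zariski T" "p \<in> T"
  shows "\<exists>d F. homogeneous_poly d F \<and> p \<in> basic_open F \<and> basic_open F \<subseteq> T"
proof -
  have "generate_topology_on {{proj_pt x | x. x \<noteq> 0 \<and> F x \<noteq> 0} | F. \<exists>d. homogeneous_poly d F} T"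
    using assms(1) unfolding zariski_def by (rule openin_topology_generated_by)
  then show ?thesis using assms(2)
  proof (induction arbitrary: p rule: generate_topology_on.induct)
    case (Int S T)
    obtain d F where F: "homogeneous_poly d F" "p \<in> basic_open F" "basic_open F \<subseteq> S"
      using Int by blast
    obtain e G where G: "homogeneous_poly e G" "p \<in> basic_open G" "basic_open G \<subseteq> T"
      using Int by blast
    obtain x where x: "x \<noteq> 0" "p = proj_pt x" using F(2) unfolding basic_open_def by blast
    have "p \<in> basic_open (\<lambda>x. F x * G x)"
      using F(2) G(2) x(1) unfolding x(2)
      by (simp add: proj_pt_in_basic_open_iff[OF F(1)] proj_pt_in_basic_open_iff[OF G(1)]
          proj_pt_in_basic_open_iff[OF homogeneous_poly_mult[OF F(1) G(1)]])
    moreover have "basic_open (\<lambda>x. F x * G x) \<subseteq> S \<inter> T"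
      using F(3) G(3) unfolding basic_open_def by auto
    ultimately show ?case using homogeneous_poly_mult[OF F(1) G(1)] by blast
  next
    case (UN K)
    then show ?case by (meson Union_iff Union_upper subset_trans)
  next
    case (Basis S)
    then show ?case unfolding basic_open_def by blast
  qed simp
qed

text \<open>
  Zariski density follows from classical density: if \<open>F\<close> does not vanish at \<open>v\<close>, then by continuity
  it does not vanish at points of the curve close to \<open>v\<close>, so the basic open set \<open>D(F)\<close> around \<open>v\<close>
  meets the locus \<open>G \<noteq> 0\<close>. This reduces density to producing, near every point of the curve,
  points of the curve outside \<open>G = 0\<close>; no irreducibility has to be shown.
\<close>

lemma dense_open_inI:
  fixes G :: "complex ^ 'n::finite \<Rightarrow> complex"
  assumes G: "homogeneous_poly d G"
    and approx: "\<And>v. v \<noteq> 0 \<Longrightarrow> P v \<Longrightarrow> \<exists>w::nat \<Rightarrow> complex ^ 'n. w \<longlonglongrightarrow> v \<and>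
      (\<forall>\<^sub>F n in sequentially. w n \<noteq> 0 \<and> P (w n) \<and> G (w n) \<noteq> 0)"
  shows "dense_open_in {proj_pt v | v. v \<noteq> 0 \<and> P v} {proj_pt v | v. v \<noteq> 0 \<and> P v \<and> G v \<noteq> 0}"
    (is "dense_open_in ?X ?U")
  unfolding dense_open_in_def
proof
  have U: "?U = basic_open G \<inter> ?X"
    unfolding basic_open_def using homogeneous_poly_nonzero_proj_pt[OF G] by blast
  then show "openin (subtopology zariski ?X) ?U"
    using openin_basic_open[OF G] openin_subtopology by blast
  have top: "topspace zariski \<supseteq> ?X"
    using openin_subset[OF openin_basic_open[OF homogeneous_poly_const[of 1]]]
    by (auto simp: basic_open_def)
  have "p \<in> (subtopology zariski ?X) closure_of ?U" if p: "p \<in> ?X" for p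
    unfolding in_closure_of
  proof (intro conjI allI impI)
    show "p \<in> topspace (subtopology zariski ?X)" using p top by auto
    fix T assume T: "p \<in> T \<and> openin (subtopology zariski ?X) T"
    then obtain T' where T': "openin zariski T'" "T = T' \<inter> ?X"
      by (auto simp: openin_subtopology)
    then obtain e F where F: "homogeneous_poly e F" "p \<in> basic_open F" "basic_open F \<subseteq> T'"
      using zariski_base[of T' p] T by auto
    from p obtain v where v: "p = proj_pt v" "v \<noteq> 0" "P v" by blast
    have "F v \<noteq> 0"
      using F(2) v proj_pt_in_basic_open_iff[OF F(1)] by blast
    obtain w where w: "w \<longlonglongrightarrow> v"
      "\<forall>\<^sub>F n in sequentially. w n \<noteq> 0 \<and> P (w n) \<and> G (w n) \<noteq> 0"
      using approx[OF v(2,3)] by blast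
    have "(\<lambda>n. F (w n)) \<longlonglongrightarrow> F v"
      using homogeneous_poly_isCont[OF F(1)] w(1) by (rule isCont_tendsto_compose)
    then have "\<forall>\<^sub>F n in sequentially. F (w n) \<noteq> 0"
      using \<open>F v \<noteq> 0\<close> by (rule tendsto_imp_eventually_ne)
    with w(2) have "\<forall>\<^sub>F n in sequentially. w n \<noteq> 0 \<and> P (w n) \<and> G (w n) \<noteq> 0 \<and> F (w n) \<noteq> 0"
      by eventually_elim auto
    then obtain n where n: "w n \<noteq> 0" "P (w n)" "G (w n) \<noteq> 0" "F (w n) \<noteq> 0"
      using eventually_happens'[OF sequentially_bot] by blast
    then have "proj_pt (w n) \<in> ?U" "proj_pt (w n) \<in> basic_open F"
      unfolding basic_open_def by blast+
    moreover have "proj_pt (w n) \<in> ?X" using n by blast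
    ultimately show "\<exists>y. y \<in> ?U \<and> y \<in> T" using F(3) T'(2) by blast
  qed
  moreover have "(subtopology zariski ?X) closure_of ?U \<subseteq> ?X"
    using closure_of_subset_topspace[of "subtopology zariski ?X" ?U] by auto
  ultimately show "(subtopology zariski ?X) closure_of ?U = ?X" by blast
qed

section \<open>Birational maps given by homogeneous forms\<close>

text \<open>
  Points are lifted to the representative chosen by \<open>homog_coords\<close>; for homogeneous components the
  choice is immaterial, by the lemma that follows.
\<close>

definition induced_map :: "(complex ^ 'n::finite \<Rightarrow> complex ^ 'm::finite) \<Rightarrow> 'n cproj \<Rightarrow> 'm cproj" where
  "induced_map F p = proj_pt (F (homog_coords p))"

lemma induced_map_proj_pt:
  assumes F: "\<And>i. homogeneous_poly d (\<lambda>x. F x $ i)" and "x \<noteq> 0" "F x \<noteq> 0"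
  shows "induced_map F (proj_pt x) = proj_pt (F x)"
proof -
  obtain c where c: "c \<noteq> 0" "homog_coords (proj_pt x) = c *s x"
    using homog_coords_proj_pt[OF assms(2)] .
  have "F (c *s x) = c ^ d *s F x"
    using homogeneous_poly_scale[OF F] by (simp add: vec_eq_iff)
  moreover have "c ^ d *s F x \<noteq> 0" using c assms(3) by simp
  ultimately show ?thesis
    unfolding induced_map_def c(2) using assms(3) c(1)
    by (metis power_not_zero proj_pt_eq_iff)
qed

lemma regular_map_on_induced_map:
  assumes F: "\<And>i. homogeneous_poly d (\<lambda>x. F x $ i)"
    and nz: "\<And>x. x \<noteq> 0 \<Longrightarrow> proj_pt x \<in> U \<Longrightarrow> F x \<noteq> 0"
    and U: "U \<subseteq> {proj_pt x | x. x \<noteq> 0}"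
  shows "regular_map_on U (induced_map F)"
  unfolding regular_map_on_def
proof
  fix p assume "p \<in> U"
  have "U \<subseteq> topspace zariski"
    using openin_subset[OF openin_basic_open[OF homogeneous_poly_const[of 1]]] U
    by (auto simp: basic_open_def)
  then have "openin (subtopology zariski U) U"
    by (metis openin_topspace topspace_subtopology_subset)
  then show "\<exists>W d F'. openin (subtopology zariski U) W \<and> p \<in> W \<and>
      (\<forall>i. homogeneous_poly d (\<lambda>x. F' x $ i)) \<and>
      (\<forall>x. x \<noteq> 0 \<longrightarrow> proj_pt x \<in> W \<longrightarrow>
        F' x \<noteq> 0 \<and> induced_map F (proj_pt x) = proj_pt (F' x))"
    using \<open>p \<in> U\<close> F nz induced_map_proj_pt[OF F]
    by (intro exI[of _ U] exI[of _ d] exI[of _ F]) auto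
qed

text \<open>
  Birational equivalence stated on homogeneous coordinates: two tuples of forms that map the
  dense open subsets \<open>H \<noteq> 0\<close> and \<open>K \<noteq> 0\<close> into each other and whose composites are scalings.
  The two maps are then bijections between these subsets, so the domains of both composites are
  the whole subsets.
\<close>

lemma birationally_equivalentI:
  fixes F :: "complex ^ 'n::finite \<Rightarrow> complex ^ 'm::finite"
    and G :: "complex ^ 'm \<Rightarrow> complex ^ 'n"
    and P H Q K
  defines "U \<equiv> {proj_pt v | v. v \<noteq> 0 \<and> P v \<and> H v \<noteq> 0}"
    and "V \<equiv> {proj_pt x | x. x \<noteq> 0 \<and> Q x \<and> K x \<noteq> 0}"
  assumes F: "\<And>i. homogeneous_poly d (\<lambda>v. F v $ i)"
    and G: "\<And>i. homogeneous_poly e (\<lambda>x. G x $ i)"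
    and P: "\<And>c v. c \<noteq> 0 \<Longrightarrow> P v \<Longrightarrow> P (c *s v)" and Q: "\<And>c x. c \<noteq> 0 \<Longrightarrow> Q x \<Longrightarrow> Q (c *s x)"
    and H: "homogeneous_poly d' H" and K: "homogeneous_poly e' K"
    and U: "dense_open_in {proj_pt v | v. v \<noteq> 0 \<and> P v} U"
    and V: "dense_open_in {proj_pt x | x. x \<noteq> 0 \<and> Q x} V"
    and FQ: "\<And>v. v \<noteq> 0 \<Longrightarrow> P v \<Longrightarrow> H v \<noteq> 0 \<Longrightarrow> F v \<noteq> 0 \<and> Q (F v) \<and> K (F v) \<noteq> 0"
    and GP: "\<And>x. x \<noteq> 0 \<Longrightarrow> Q x \<Longrightarrow> K x \<noteq> 0 \<Longrightarrow> G x \<noteq> 0 \<and> P (G x) \<and> H (G x) \<noteq> 0"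
    and GF: "\<And>v. v \<noteq> 0 \<Longrightarrow> P v \<Longrightarrow> H v \<noteq> 0 \<Longrightarrow> \<exists>c. c \<noteq> 0 \<and> G (F v) = c *s v"
    and FG: "\<And>x. x \<noteq> 0 \<Longrightarrow> Q x \<Longrightarrow> K x \<noteq> 0 \<Longrightarrow> \<exists>c. c \<noteq> 0 \<and> F (G x) = c *s x"
  shows "birationally_equivalent {proj_pt v | v. v \<noteq> 0 \<and> P v} {proj_pt x | x. x \<noteq> 0 \<and> Q x}"
proof -
  have U_iff: "proj_pt v \<in> U \<longleftrightarrow> P v \<and> H v \<noteq> 0" if v: "v \<noteq> 0" for v
  proof
    assume "proj_pt v \<in> U"
    then obtain v' where v': "v' \<noteq> 0" "P v'" "H v' \<noteq> 0" "proj_pt v' = proj_pt v"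
      unfolding U_def by force
    then obtain c where "c \<noteq> 0" "v = c *s v'" using v v'(1,4) proj_pt_eq_iff[of v' v] by auto
    then show "P v \<and> H v \<noteq> 0" using v' P homogeneous_poly_scale[OF H] by simp
  qed (use that U_def in blast)
  have V_iff: "proj_pt x \<in> V \<longleftrightarrow> Q x \<and> K x \<noteq> 0" if x: "x \<noteq> 0" for x
  proof
    assume "proj_pt x \<in> V"
    then obtain x' where x': "x' \<noteq> 0" "Q x'" "K x' \<noteq> 0" "proj_pt x' = proj_pt x"
      unfolding V_def by force
    then obtain c where "c \<noteq> 0" "x = c *s x'" using x x'(1,4) proj_pt_eq_iff[of x' x] by auto
    then show "Q x \<and> K x \<noteq> 0" using x' Q homogeneous_poly_scale[OF K] by simp
  qed (use that V_def in blast)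
  have FU: "induced_map F p \<in> V \<and> induced_map G (induced_map F p) = p" if p: "p \<in> U" for p
  proof -
    obtain v where v: "p = proj_pt v" "v \<noteq> 0" "P v" "H v \<noteq> 0" using p U_def by blast
    note f = FQ[OF v(2-4)]
    obtain c where "c \<noteq> 0" "G (F v) = c *s v" using GF[OF v(2-4)] by blast
    then have "proj_pt (G (F v)) = p" "G (F v) \<noteq> 0"
      using v(1,2) proj_pt_eq_iff[of v "G (F v)"] by auto
    then show ?thesis
      using f v(1,2) induced_map_proj_pt[OF F] induced_map_proj_pt[OF G] V_iff by simp
  qed
  have GV: "induced_map G q \<in> U \<and> induced_map F (induced_map G q) = q" if q: "q \<in> V" for q
  proof -
    obtain x where x: "q = proj_pt x" "x \<noteq> 0" "Q x" "K x \<noteq> 0" using q V_def by blast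
    note g = GP[OF x(2-4)]
    obtain c where "c \<noteq> 0" "F (G x) = c *s x" using FG[OF x(2-4)] by blast
    then have "proj_pt (F (G x)) = q" "F (G x) \<noteq> 0"
      using x(1,2) proj_pt_eq_iff[of x "F (G x)"] by auto
    then show ?thesis
      using g x(1,2) induced_map_proj_pt[OF F] induced_map_proj_pt[OF G] U_iff by simp
  qed
  have "{p \<in> U. induced_map F p \<in> V} = U" "{q \<in> V. induced_map G q \<in> U} = V"
    using FU GV by auto
  moreover have "rational_map {proj_pt v | v. v \<noteq> 0 \<and> P v} {proj_pt x | x. x \<noteq> 0 \<and> Q x} U (induced_map F)"
    unfolding rational_map_def
  proof (intro conjI)
    show "regular_map_on U (induced_map F)"
      by (rule regular_map_on_induced_map[OF F]) (use U_iff FQ in \<open>auto simp: U_def\<close>)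
    show "induced_map F ` U \<subseteq> {proj_pt x | x. x \<noteq> 0 \<and> Q x}"
      using FU unfolding V_def by blast
  qed fact
  moreover have "rational_map {proj_pt x | x. x \<noteq> 0 \<and> Q x} {proj_pt v | v. v \<noteq> 0 \<and> P v} V (induced_map G)"
    unfolding rational_map_def
  proof (intro conjI)
    show "regular_map_on V (induced_map G)"
      by (rule regular_map_on_induced_map[OF G]) (use V_iff GP in \<open>auto simp: V_def\<close>)
    show "induced_map G ` V \<subseteq> {proj_pt v | v. v \<noteq> 0 \<and> P v}"
      using GV unfolding U_def by blast
  qed fact
  ultimately show ?thesis
    unfolding birationally_equivalent_def using U V FU GV
    by (intro exI[of _ U] exI[of _ "induced_map F"] exI[of _ V] exI[of _ "induced_map G"]) auto
qed

section \<open>Continuity of roots\<close>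

text \<open>
  The product of the roots has absolute value \<open>\<bar>p(0)\<bar> / \<bar>lead_coeff p\<bar>\<close>, so a root of smallest
  absolute value satisfies the bound. The induction splits off one linear factor and keeps the
  smaller of its root and the root found for the cofactor.
\<close>

lemma small_root:
  fixes p :: "complex poly"
  assumes "degree p = Suc n"
  shows "\<exists>r. poly p r = 0 \<and> norm (lead_coeff p) * norm r ^ Suc n \<le> norm (poly p 0)"
  using assms
proof (induction n arbitrary: p)
  case 0
  obtain a b where p: "p = [:a, b:]" "b \<noteq> 0"
    using 0 degree1_coeffs by (metis One_nat_def)
  then show ?case by (intro exI[of _ "-a / b"]) (auto simp: norm_divide)
next
  case (Suc n)
  obtain r where r: "poly p r = 0"
    using Suc.prems fundamental_theorem_of_algebra_alt by (metis degree_pCons_0 Zero_not_Suc)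
  then obtain q where p: "p = [:-r, 1:] * q" by (auto simp: poly_eq_0_iff_dvd elim: dvdE)
  have "q \<noteq> 0" using p Suc.prems by auto
  then have "degree q = Suc n" using Suc.prems p by (simp add: degree_mult_eq del: mult_pCons_left)
  then obtain r' where r': "poly q r' = 0" "norm (lead_coeff q) * norm r' ^ Suc n \<le> norm (poly q 0)"
    using Suc.IH by blast
  have lc: "lead_coeff p = lead_coeff q"
    unfolding p by (subst lead_coeff_mult) simp
  have p0: "norm (poly p 0) = norm r * norm (poly q 0)"
    unfolding p by (simp add: norm_mult)
  define s where "s = (if norm r \<le> norm r' then r else r')"
  have "norm (lead_coeff p) * norm s ^ Suc (Suc n) = norm s * (norm (lead_coeff q) * norm s ^ Suc n)"
    using lc by simp
  also have "\<dots> \<le> norm r * (norm (lead_coeff q) * norm r' ^ Suc n)"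
    by (intro mult_mono power_mono) (auto simp: s_def)
  also have "\<dots> \<le> norm (poly p 0)"
    unfolding p0 using r'(2) by (intro mult_left_mono) auto
  finally show ?case using r r'(1) p by (intro exI[of _ s]) (auto simp: s_def)
qed

text \<open>
  A quantitative continuity of roots: if the constant terms tend to \<open>0\<close> while the leading
  coefficients stay away from \<open>0\<close>, the polynomials have roots tending to \<open>0\<close>. Applied to the
  restrictions of an equation to a family of lines, this shows that the points of a curve are not
  isolated.
\<close>

lemma roots_tendsto_0:
  fixes p :: "nat \<Rightarrow> complex poly"
  assumes deg: "\<And>k. degree (p k) \<le> Suc n"
    and lc: "(\<lambda>k. coeff (p k) (Suc n)) \<longlonglongrightarrow> c" "c \<noteq> 0"
    and p0: "(\<lambda>k. poly (p k) 0) \<longlonglongrightarrow> 0"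
  obtains r where "r \<longlonglongrightarrow> 0" "\<forall>\<^sub>F k in sequentially. poly (p k) (r k) = 0"
proof -
  let ?ok = "\<lambda>k r. poly (p k) r = 0 \<and> norm (coeff (p k) (Suc n)) * norm r ^ Suc n \<le> norm (poly (p k) 0)"
  define r where "r k = (SOME r. ?ok k r)" for k
  have nz: "\<forall>\<^sub>F k in sequentially. coeff (p k) (Suc n) \<noteq> 0"
    using lc by (rule tendsto_imp_eventually_ne)
  then have ok: "\<forall>\<^sub>F k in sequentially. ?ok k (r k)"
  proof eventually_elim
    case (elim k)
    then have "degree (p k) = Suc n" using deg[of k] le_degree le_antisym by metis
    then show ?case unfolding r_def using small_root[of "p k" n] by (metis (mono_tags, lifting) someI_ex)
  qed
  have lim: "(\<lambda>k. norm (poly (p k) 0) / norm (coeff (p k) (Suc n))) \<longlonglongrightarrow> 0"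
    using tendsto_divide[OF tendsto_norm[OF p0] tendsto_norm[OF lc(1)]] lc(2) by simp
  have "\<forall>\<^sub>F k in sequentially. norm (norm (r k) ^ Suc n) \<le> norm (poly (p k) 0) / norm (coeff (p k) (Suc n))"
    using ok nz by eventually_elim (simp add: field_simps)
  then have "(\<lambda>k. norm (r k) ^ Suc n) \<longlonglongrightarrow> 0"
    using lim by (rule Lim_null_comparison)
  then have "(\<lambda>k. norm (r k)) \<longlonglongrightarrow> 0"
    using tendsto_real_root[of "\<lambda>k. norm (r k) ^ Suc n" 0 sequentially "Suc n"]
    by (simp add: real_root_power_cancel del: power_Suc)
  then have "r \<longlonglongrightarrow> 0" by (simp add: tendsto_norm_zero_iff)
  then show thesis using that ok by (simp add: eventually_conj_iff)
qed

lemma approx_avoiding_finite: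
  fixes z :: complex
  assumes "\<And>n::nat. finite (R n)"
  obtains \<sigma> where "\<sigma> \<longlonglongrightarrow> z" "\<And>n. \<sigma> n \<notin> R n"
proof -
  have "\<exists>y. dist y z < inverse (real (Suc n)) \<and> y \<notin> R n" for n
  proof -
    have "uncountable (ball z (inverse (real (Suc n))))" by (rule uncountable_ball) simp
    then have "infinite (ball z (inverse (real (Suc n))))" using countable_finite by blast
    then obtain y where "y \<in> ball z (inverse (real (Suc n)))" "y \<notin> R n"
      using assms by (meson finite_subset subsetI)
    then show ?thesis by (auto simp: dist_commute)
  qed
  then obtain \<sigma> where \<sigma>: "\<And>n. dist (\<sigma> n) z < inverse (real (Suc n))" "\<And>n. \<sigma> n \<notin> R n"
    by metis
  have "\<sigma> \<longlonglongrightarrow> z"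
    by (rule metric_tendsto_imp_tendsto[OF LIMSEQ_inverse_real_of_nat])
      (use \<sigma>(1) in \<open>auto intro!: always_eventually less_imp_le simp: dist_real_def\<close>)
  then show thesis using that \<sigma>(2) by blast
qed

section \<open>Bring's curve in diagonal coordinates\<close>

text \<open>
  An enumeration of the fifth roots of unity by the five coordinates of \<open>complex ^ 5\<close>. The order
  is left open, since the equations of Bring's curve are symmetric in the coordinates.
\<close>

definition root5 :: "5 \<Rightarrow> complex" where
  "root5 = (SOME f. bij_betw f UNIV {z. z ^ 5 = 1})"

lemma bij_betw_root5: "bij_betw root5 UNIV {z. z ^ 5 = 1}"
proof -
  have "card (UNIV :: 5 set) = card {z :: complex. z ^ 5 = 1}"
    by (subst card_roots_unity_eq) auto
  then have "\<exists>f. bij_betw f (UNIV :: 5 set) {z :: complex. z ^ 5 = 1}"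
    by (intro finite_same_card_bij finite_roots_unity) auto
  then show ?thesis unfolding root5_def by (rule someI_ex)
qed

lemma root5_power5 [simp]: "root5 i ^ 5 = 1"
  using bij_betw_root5 bij_betwE by fastforce

lemma sum_root5_power:
  assumes "k \<in> {1, 2, 3, 4}"
  shows "(\<Sum>i\<in>UNIV. root5 i ^ k) = 0"
proof -
  have "(\<Sum>i\<in>UNIV. root5 i ^ k) = (\<Sum>z | z ^ 5 = 1. z ^ k)"
    using bij_betw_root5 by (rule sum.reindex_bij_betw)
  also have "\<dots> = (\<Sum>z::complex | z ^ 5 = 1. z)"
  proof -
    have red: "z ^ 6 = z \<and> z ^ 8 = z ^ 3 \<and> z ^ 9 = z ^ 4 \<and> z ^ 16 = z" if "z ^ 5 = 1" for z :: complex
      using power_add[of z 5 1] power_add[of z 5 3] power_add[of z 5 4] power_add[of z 15 1]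
        power_mult[of z 5 3] that by simp
    \<comment> \<open>\<open>l\<close> is the inverse of \<open>k\<close> modulo 5, so \<open>z \<mapsto> z ^ l\<close> inverts \<open>z \<mapsto> z ^ k\<close> on the roots of unity.\<close>
    define l :: nat where "l = (if k = 2 then 3 else if k = 3 then 2 else k)"
    have kl: "(z ^ k) ^ l = z \<and> (z ^ l) ^ k = z" if "z ^ 5 = 1" for z :: complex
      using assms red[OF that] by (auto simp: l_def simp flip: power_mult)
    show ?thesis
    proof (rule sum.reindex_bij_witness[where i = "\<lambda>z. z ^ l" and j = "\<lambda>z. z ^ k"])
      fix z :: complex assume "z \<in> {z. z ^ 5 = 1}"
      then show "(z ^ k) ^ l = z" "(z ^ l) ^ k = z" using kl by auto
      show "z ^ k \<in> {z. z ^ 5 = 1}" "z ^ l \<in> {z. z ^ 5 = 1}"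
        using \<open>z \<in> _\<close> power_mult[of z 5 k] power_mult[of z k 5]
          power_mult[of z 5 l] power_mult[of z l 5] by (simp_all add: mult.commute)
    qed simp
  qed
  also have "\<dots> = 0" by (rule sum_roots_unity) simp
  finally show ?thesis .
qed

text \<open>
  Coordinates on the hyperplane \<open>\<Sum>i. x $ i = 0\<close> that diagonalise a cyclic permutation of order 5.
  The signs in front of \<open>b\<close> and \<open>d\<close> make the equations of Bring's curve match the four cubics
  in \<open>to_bring\<close> below.
\<close>

definition vec_of_fourier :: "complex \<Rightarrow> complex \<Rightarrow> complex \<Rightarrow> complex \<Rightarrow> complex ^ 5" where
  "vec_of_fourier a b c d = (\<chi> i. a * root5 i - b * root5 i ^ 2 + c * root5 i ^ 3 - d * root5 i ^ 4)"

text \<open>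
  The exponent \<open>5 - k\<close> stands for \<open>- k\<close>.
\<close>

definition fourier_coeff :: "nat \<Rightarrow> complex ^ 5 \<Rightarrow> complex" where
  "fourier_coeff k x = (\<Sum>i\<in>UNIV. root5 i ^ (5 - k) * x $ i) / 5"

abbreviation "coeffA x \<equiv> fourier_coeff 1 x"
abbreviation "coeffB x \<equiv> - fourier_coeff 2 x"
abbreviation "coeffC x \<equiv> fourier_coeff 3 x"
abbreviation "coeffD x \<equiv> - fourier_coeff 4 x"

text \<open>
  Summing over all fifth roots of unity picks out the constant term of the residue
  modulo \<open>w ^ 5 - 1\<close>; the power sums of \<open>x\<close> are computed this way.
\<close>

lemma sum_root5_eq:
  assumes "\<And>w. w ^ 5 = 1 \<Longrightarrow> f w = c0 + c1 * w + c2 * w ^ 2 + c3 * w ^ 3 + c4 * w ^ 4"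
  shows "(\<Sum>i\<in>UNIV. f (root5 i)) = 5 * c0"
  using sum_root5_power[of 1] sum_root5_power[of 2] sum_root5_power[of 3] sum_root5_power[of 4]
  by (simp add: assms sum.distrib flip: sum_distrib_left)

lemma fourier_coeff_vec_of_fourier:
  "coeffA (vec_of_fourier a b c d) = a" "coeffB (vec_of_fourier a b c d) = b"
  "coeffC (vec_of_fourier a b c d) = c" "coeffD (vec_of_fourier a b c d) = d"
proof -
  let ?f = "\<lambda>w. a * w - b * w ^ 2 + c * w ^ 3 - d * w ^ 4"
  have "(\<Sum>i\<in>UNIV. root5 i ^ 4 * ?f (root5 i)) = 5 * a"
    by (rule sum_root5_eq[where ?c1.0 = "-b" and ?c2.0 = c and ?c3.0 = "-d" and ?c4.0 = 0]) algebra
  moreover have "(\<Sum>i\<in>UNIV. root5 i ^ 3 * ?f (root5 i)) = 5 * (- b)"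
    by (rule sum_root5_eq[where ?c1.0 = c and ?c2.0 = "-d" and ?c3.0 = 0 and ?c4.0 = a]) algebra
  moreover have "(\<Sum>i\<in>UNIV. root5 i ^ 2 * ?f (root5 i)) = 5 * c"
    by (rule sum_root5_eq[where ?c1.0 = "-d" and ?c2.0 = 0 and ?c3.0 = a and ?c4.0 = "-b"]) algebra
  moreover have "(\<Sum>i\<in>UNIV. root5 i * ?f (root5 i)) = 5 * (- d)"
    by (rule sum_root5_eq[where ?c1.0 = 0 and ?c2.0 = a and ?c3.0 = "-b" and ?c4.0 = c]) algebra
  ultimately show "coeffA (vec_of_fourier a b c d) = a" "coeffB (vec_of_fourier a b c d) = b"
    "coeffC (vec_of_fourier a b c d) = c" "coeffD (vec_of_fourier a b c d) = d"
    unfolding fourier_coeff_def vec_of_fourier_def by simp_all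
qed

lemma sum_vec_of_fourier:
  "(\<Sum>i\<in>UNIV. vec_of_fourier a b c d $ i) = 0"
  using sum_root5_eq[of "\<lambda>w. a * w - b * w ^ 2 + c * w ^ 3 - d * w ^ 4" 0 a "-b" c "-d"]
  by (simp add: vec_of_fourier_def)

lemma sum_vec_of_fourier_power2:
  "(\<Sum>i\<in>UNIV. (vec_of_fourier a b c d $ i) ^ 2) = 5 * (- 2 * (a * d + b * c))"
  unfolding vec_of_fourier_def vec_lambda_beta
  by (rule sum_root5_eq[where ?c1.0 = "c ^ 2 + 2 * b * d" and ?c2.0 = "a ^ 2 - 2 * c * d"
        and ?c3.0 = "d ^ 2 - 2 * a * b" and ?c4.0 = "b ^ 2 + 2 * a * c"]) algebra

lemma sum_vec_of_fourier_power3: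
  "(\<Sum>i\<in>UNIV. (vec_of_fourier a b c d $ i) ^ 3)
    = 5 * (3 * (a ^ 2 * c - b * d ^ 2 + a * b ^ 2 - c ^ 2 * d))"
  unfolding vec_of_fourier_def vec_lambda_beta
  by (rule sum_root5_eq[where
        ?c1.0 = "- (b ^ 3) - 6 * a * b * c - 3 * a ^ 2 * d + 3 * c * d ^ 2" and
        ?c2.0 = "3 * a * c ^ 2 + 6 * a * b * d + 3 * b ^ 2 * c - d ^ 3" and
        ?c3.0 = "a ^ 3 - 3 * b * c ^ 2 - 6 * a * c * d - 3 * b ^ 2 * d" and
        ?c4.0 = "c ^ 3 - 3 * a ^ 2 * b + 3 * a * d ^ 2 + 6 * b * c * d"]) algebra

lemma fourier_inversion:
  assumes "(\<Sum>i\<in>UNIV. x $ i) = 0"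
  shows "vec_of_fourier (coeffA x) (coeffB x) (coeffC x) (coeffD x) = x"
proof -
  have geom: "1 + w * u ^ 4 + w ^ 2 * u ^ 3 + w ^ 3 * u ^ 2 + w ^ 4 * u = (if w = u then 5 else 0)"
    if "w ^ 5 = 1" "u ^ 5 = 1" for w u :: complex
  proof (cases "w = u")
    case True
    have "1 + w * u ^ 4 + w ^ 2 * u ^ 3 + w ^ 3 * u ^ 2 + w ^ 4 * u = 5"
      using that True by algebra
    then show ?thesis unfolding if_P[OF True] .
  next
    case False
    have "(w - u) * (1 + w * u ^ 4 + w ^ 2 * u ^ 3 + w ^ 3 * u ^ 2 + w ^ 4 * u) = 0"
      using that by algebra
    then show ?thesis using False by simp
  qed
  have inj: "root5 i = root5 j \<longleftrightarrow> i = j" for i j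
    using bij_betw_root5 by (auto simp: bij_betw_def inj_on_def)
  have "vec_of_fourier (coeffA x) (coeffB x) (coeffC x) (coeffD x) $ i = x $ i" for i
  proof -
    let ?w = "root5 i"
    have "5 * vec_of_fourier (coeffA x) (coeffB x) (coeffC x) (coeffD x) $ i =
        (\<Sum>j\<in>UNIV. x $ j) + ?w * (\<Sum>j\<in>UNIV. root5 j ^ 4 * x $ j) + ?w ^ 2 * (\<Sum>j\<in>UNIV. root5 j ^ 3 * x $ j)
        + ?w ^ 3 * (\<Sum>j\<in>UNIV. root5 j ^ 2 * x $ j) + ?w ^ 4 * (\<Sum>j\<in>UNIV. root5 j * x $ j)"
      by (simp add: vec_of_fourier_def fourier_coeff_def assms field_simps)
    also have "\<dots> = (\<Sum>j\<in>UNIV. (1 + ?w * root5 j ^ 4 + ?w ^ 2 * root5 j ^ 3 + ?w ^ 3 * root5 j ^ 2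
        + ?w ^ 4 * root5 j) * x $ j)"
      by (simp add: sum_distrib_left sum.distrib[symmetric] algebra_simps)
    also have "\<dots> = (\<Sum>j\<in>UNIV. if i = j then 5 * x $ j else 0)"
      by (intro sum.cong) (auto simp: geom inj)
    also have "\<dots> = 5 * x $ i" by simp
    finally show ?thesis by simp
  qed
  then show ?thesis by (simp add: vec_eq_iff)
qed

definition on_bring :: "complex ^ 5 \<Rightarrow> bool" where
  "on_bring x \<longleftrightarrow> (\<Sum>i\<in>UNIV. x $ i) = 0 \<and> (\<Sum>i\<in>UNIV. (x $ i) ^ 2) = 0 \<and> (\<Sum>i\<in>UNIV. (x $ i) ^ 3) = 0"

text \<open>
  In the diagonal coordinates Bring's curve is the intersection of a smooth quadric and a cubic
  in projective 3-space.
\<close>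

lemma on_bring_vec_of_fourier:
  "on_bring (vec_of_fourier a b c d) \<longleftrightarrow>
    a * d + b * c = 0 \<and> a ^ 2 * c - b * d ^ 2 + a * b ^ 2 - c ^ 2 * d = 0"
  unfolding on_bring_def
  by (simp only: sum_vec_of_fourier sum_vec_of_fourier_power2 sum_vec_of_fourier_power3
      mult_eq_0_iff) simp

section \<open>The two rational maps\<close>

definition hc_form :: "complex \<Rightarrow> complex \<Rightarrow> complex \<Rightarrow> complex" where
  "hc_form X Y Z = X * (Y ^ 5 + Z ^ 5) + (X * Y * Z) ^ 2 - X ^ 4 * Y * Z - 2 * (Y * Z) ^ 3"

definition on_hc :: "complex ^ 3 \<Rightarrow> bool" where
  "on_hc v \<longleftrightarrow> hc_form (v $ 1) (v $ 2) (v $ 3) = 0"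

text \<open>
  The map to Bring's curve is used where this form does not vanish. On the plane curve it
  vanishes exactly at the six nodes and at the points \<open>[0:1:0]\<close> and \<open>[0:0:1]\<close>.
\<close>

definition hc_boundary :: "complex ^ 3 \<Rightarrow> complex" where
  "hc_boundary v = v $ 2 * v $ 3 * ((v $ 1) ^ 2 - v $ 2 * v $ 3)"

text \<open>
  The last factor is the pullback of \<open>X\<^sup>2 - Y Z\<close> under \<open>to_hc\<close>.
\<close>

definition bring_boundary :: "complex ^ 5 \<Rightarrow> complex" where
  "bring_boundary x = coeffA x * coeffB x * coeffD x *
     (((coeffA x) ^ 2 - coeffC x * coeffD x) ^ 2 - (coeffA x * coeffB x) * (coeffB x * coeffD x))"

text \<open>
  The four cubics span the space of cubic forms through the six nodes of the plane curve.
\<close>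

definition to_bring :: "complex ^ 3 \<Rightarrow> complex ^ 5" where
  "to_bring v = vec_of_fourier
     (v $ 2 * ((v $ 1) ^ 2 - v $ 2 * v $ 3)) (v $ 1 * (v $ 2) ^ 2 - (v $ 3) ^ 3)
     (v $ 1 * (v $ 3) ^ 2 - (v $ 2) ^ 3) (v $ 3 * ((v $ 1) ^ 2 - v $ 2 * v $ 3))"

text \<open>
  The cubics \<open>a, b, c, d\<close> of \<open>to_bring\<close> satisfy the linear syzygies \<open>b X - a Y + c Z = 0\<close>
  and \<open>a Z - d Y = 0\<close>. The vector product of their coefficient vectors \<open>(b, -a, c)\<close> and
  \<open>(0, -d, a)\<close> is minus the vector defined here, which is therefore proportional to \<open>(X, Y, Z)\<close>.
\<close>

definition to_hc :: "complex ^ 5 \<Rightarrow> complex ^ 3" where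
  "to_hc x = vector [(coeffA x) ^ 2 - coeffC x * coeffD x, coeffA x * coeffB x, coeffB x * coeffD x]"

lemma homogeneous_poly_fourier_coeff: "homogeneous_poly 1 (fourier_coeff k)"
proof -
  have "homogeneous_poly 1 (\<lambda>x. root5 i ^ (5 - k) * x $ i)" for i
    using homogeneous_poly_mult[OF homogeneous_poly_const homogeneous_poly_coord, of _ i] by simp
  then have "homogeneous_poly 1 (\<lambda>x. \<Sum>i\<in>UNIV. root5 i ^ (5 - k) * x $ i)"
    by (intro homogeneous_poly_sum) simp_all
  from homogeneous_poly_mult[OF homogeneous_poly_const this, of "inverse 5"]
  show ?thesis by (simp add: fourier_coeff_def[abs_def] field_simps)
qed

lemmas form_intros = homogeneous_poly_intros homogeneous_poly_fourier_coeff

lemma homogeneous_poly_to_bring: "homogeneous_poly 3 (\<lambda>v. to_bring v $ i)"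
  unfolding to_bring_def vec_of_fourier_def vec_lambda_beta
  by (rule homogeneous_poly_degree_eq, (rule form_intros | simp)+)

lemma homogeneous_poly_to_hc: "homogeneous_poly 2 (\<lambda>v. to_hc v $ i)"
proof -
  have "\<forall>i. homogeneous_poly 2 (\<lambda>v. to_hc v $ i)"
    unfolding to_hc_def forall_3 vector_3
    by (intro conjI; rule homogeneous_poly_degree_eq, (rule form_intros | simp)+)
  then show ?thesis ..
qed

lemma homogeneous_poly_hc_boundary: "homogeneous_poly 4 (\<lambda>v. hc_boundary v)"
  unfolding hc_boundary_def
  by (rule homogeneous_poly_degree_eq, (rule form_intros | simp)+)

lemma homogeneous_poly_bring_boundary: "homogeneous_poly 7 (\<lambda>x. bring_boundary x)"
  unfolding bring_boundary_def
  by (rule homogeneous_poly_degree_eq, (rule form_intros | simp)+)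

lemma on_hc_scale: "on_hc v \<Longrightarrow> on_hc (c *s v)"
proof -
  have "homogeneous_poly 6 (\<lambda>v::complex^3. hc_form (v $ 1) (v $ 2) (v $ 3))"
    unfolding hc_form_def
    by (rule homogeneous_poly_degree_eq, (rule form_intros | simp)+)
  from homogeneous_poly_scale[OF this] show "on_hc v \<Longrightarrow> on_hc (c *s v)"
    unfolding on_hc_def by simp
qed

lemma on_bring_scale: "on_bring x \<Longrightarrow> on_bring (c *s x)"
  unfolding on_bring_def by (simp add: power_mult_distrib flip: sum_distrib_left)

lemma on_bring_coeffs:
  assumes "on_bring x"
  shows "coeffA x * coeffD x + coeffB x * coeffC x = 0"
    "(coeffA x)\<^sup>2 * coeffC x - coeffB x * (coeffD x)\<^sup>2 + coeffA x * (coeffB x)\<^sup>2 - (coeffC x)\<^sup>2 * coeffD x = 0"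
    "vec_of_fourier (coeffA x) (coeffB x) (coeffC x) (coeffD x) = x"
proof -
  show *: "vec_of_fourier (coeffA x) (coeffB x) (coeffC x) (coeffD x) = x"
    using assms fourier_inversion unfolding on_bring_def by blast
  show "coeffA x * coeffD x + coeffB x * coeffC x = 0"
    "(coeffA x)\<^sup>2 * coeffC x - coeffB x * (coeffD x)\<^sup>2 + coeffA x * (coeffB x)\<^sup>2 - (coeffC x)\<^sup>2 * coeffD x = 0"
    using assms on_bring_vec_of_fourier[of "coeffA x" "coeffB x" "coeffC x" "coeffD x"] unfolding * by blast+
qed

lemma vec_of_fourier_scale:
  "vec_of_fourier (k * a) (k * b) (k * c) (k * d) = k *s vec_of_fourier a b c d"
  by (simp add: vec_of_fourier_def vec_eq_iff algebra_simps)

lemma to_hc_vec_of_fourier: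
  "to_hc (vec_of_fourier a b c d) = vector [a\<^sup>2 - c * d, a * b, b * d]"
  unfolding to_hc_def fourier_coeff_vec_of_fourier ..

lemma bring_boundary_vec_of_fourier:
  "bring_boundary (vec_of_fourier a b c d) = a * b * d * ((a\<^sup>2 - c * d)\<^sup>2 - (a * b) * (b * d))"
  unfolding bring_boundary_def fourier_coeff_vec_of_fourier ..

text \<open>
  The cubic equation holds identically in \<open>X, Y, Z\<close>; the quadratic form pulls back to minus the
  sextic form of the plane curve.
\<close>

lemma on_bring_to_bring:
  assumes "on_hc v"
  shows "on_bring (to_bring v)"
proof -
  have "(Y * (X\<^sup>2 - Y * Z)) * (Z * (X\<^sup>2 - Y * Z)) + (X * Y\<^sup>2 - Z ^ 3) * (X * Z\<^sup>2 - Y ^ 3)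
      = - hc_form X Y Z" for X Y Z
    unfolding hc_form_def by algebra
  moreover have "(Y * (X\<^sup>2 - Y * Z))\<^sup>2 * (X * Z\<^sup>2 - Y ^ 3) - (X * Y\<^sup>2 - Z ^ 3) * (Z * (X\<^sup>2 - Y * Z))\<^sup>2
      + (Y * (X\<^sup>2 - Y * Z)) * (X * Y\<^sup>2 - Z ^ 3)\<^sup>2 - (X * Z\<^sup>2 - Y ^ 3)\<^sup>2 * (Z * (X\<^sup>2 - Y * Z)) = 0"
    for X Y Z :: complex
    by algebra
  ultimately show ?thesis
    using assms unfolding to_bring_def on_bring_vec_of_fourier on_hc_def by simp
qed

lemma to_hc_to_bring:
  "to_hc (to_bring v) = (((v $ 1)\<^sup>2 - v $ 2 * v $ 3) * (v $ 1 * (v $ 2)\<^sup>2 - (v $ 3) ^ 3)) *s v"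
  unfolding to_bring_def to_hc_vec_of_fourier vec_eq_iff forall_3 vector_3 vector_smult_component
  by (intro conjI) algebra+

text \<open>
  By the quadratic equation \<open>a d = - b c\<close>, the cubic \<open>b\<close> can vanish only together with
  \<open>a d = Y Z (X\<^sup>2 - Y Z)\<^sup>2\<close>.
\<close>

lemma on_hc_nonzero:
  assumes "on_hc v" "hc_boundary v \<noteq> 0"
  shows "v $ 1 * (v $ 2)\<^sup>2 - (v $ 3) ^ 3 \<noteq> 0"
proof
  assume "v $ 1 * (v $ 2)\<^sup>2 - (v $ 3) ^ 3 = 0"
  then have "hc_boundary v * ((v $ 1)\<^sup>2 - v $ 2 * v $ 3) = 0"
    using assms(1) unfolding on_hc_def hc_form_def hc_boundary_def by algebra
  then show False using assms(2) by (auto simp: hc_boundary_def)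
qed

lemma to_bring_nonzero:
  assumes "on_hc v" "hc_boundary v \<noteq> 0"
  shows "bring_boundary (to_bring v) \<noteq> 0"
proof -
  define q b where "q = (v $ 1)\<^sup>2 - v $ 2 * v $ 3" and "b = v $ 1 * (v $ 2)\<^sup>2 - (v $ 3) ^ 3"
  have "bring_boundary (to_bring v) = (v $ 2 * q) * b * (v $ 3 * q) * ((q * b)\<^sup>2 * q)"
    unfolding to_bring_def bring_boundary_vec_of_fourier q_def b_def by algebra
  then show ?thesis
    using on_hc_nonzero[OF assms] assms(2) unfolding hc_boundary_def by (simp add: q_def b_def)
qed

text \<open>
  The first and last coordinates agree identically, the second one by the cubic equation, the third
  one by both equations after cancelling \<open>coeffB x\<close>.
\<close>

lemma to_hc_inverse:
  assumes "on_bring x"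
  defines "q \<equiv> ((coeffA x) ^ 2 - coeffC x * coeffD x) ^ 2 - (coeffA x * coeffB x) * (coeffB x * coeffD x)"
  assumes "coeffB x \<noteq> 0"
  shows "to_bring (to_hc x) = (coeffB x * q) *s x"
proof -
  define a b c d where abcd: "a = coeffA x" "b = coeffB x" "c = coeffC x" "d = coeffD x"
  have 1: "a * d + b * c = 0" "a\<^sup>2 * c - b * d\<^sup>2 + a * b\<^sup>2 - c\<^sup>2 * d = 0"
    and x: "vec_of_fourier a b c d = x"
    using on_bring_coeffs[OF assms(1)] unfolding abcd by blast+
  have q: "q = (a\<^sup>2 - c * d)\<^sup>2 - (a * b) * (b * d)" unfolding q_def abcd ..
  have b: "b \<noteq> 0" using assms(3) unfolding abcd .
  have C: "(a\<^sup>2 - c * d) * (b * d)\<^sup>2 - (a * b) ^ 3 = (b * q) * c"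
    unfolding q using 1 b by algebra
  have B: "(a\<^sup>2 - c * d) * (a * b)\<^sup>2 - (b * d) ^ 3 = (b * q) * b"
    unfolding q using 1 b by algebra
  have A: "a * b * ((a\<^sup>2 - c * d)\<^sup>2 - a * b * (b * d)) = (b * q) * a"
    and D: "b * d * ((a\<^sup>2 - c * d)\<^sup>2 - a * b * (b * d)) = (b * q) * d"
    unfolding q by algebra+
  have "to_bring (to_hc x) = vec_of_fourier ((b * q) * a) ((b * q) * b) ((b * q) * c) ((b * q) * d)"
    unfolding to_bring_def to_hc_def vector_3 abcd[symmetric] A B C D ..
  then show ?thesis unfolding vec_of_fourier_scale x by (simp only: abcd)
qed

lemma on_hc_to_hc:
  assumes "on_bring x"
  shows "on_hc (to_hc x)"
proof -
  define a b c d where abcd: "a = coeffA x" "b = coeffB x" "c = coeffC x" "d = coeffD x"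
  have 1: "a * d + b * c = 0" "a\<^sup>2 * c - b * d\<^sup>2 + a * b\<^sup>2 - c\<^sup>2 * d = 0"
    using on_bring_coeffs[OF assms(1)] unfolding abcd by blast+
  show ?thesis
    unfolding on_hc_def to_hc_def vector_3 abcd[symmetric] hc_form_def using 1 by algebra
qed

section \<open>Density on the plane curve\<close>

text \<open>
  Apart from \<open>X\<close>, the form excluded here is \<open>Y ^ 5 - Z ^ 5\<close> written in terms of \<open>Y - Z\<close> and \<open>X\<close>
  by means of \<open>X\<^sup>2 = Y Z\<close>. It vanishes at the nodes \<open>[1 : \<zeta> : 1/\<zeta>]\<close> with \<open>\<zeta> ^ 5 = 1\<close>. It depends
  only on \<open>X\<close> and \<open>Y - Z\<close>, that is, it is constant along lines in the direction \<open>(0, 1, 1)\<close>.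
\<close>

lemma hc_boundary_nonzero:
  assumes "hc_form X Y Z = 0" "X \<noteq> 0" "(Y - Z) ^ 5 + 5 * (Y - Z) ^ 3 * X\<^sup>2 + 5 * (Y - Z) * X ^ 4 \<noteq> 0"
  shows "Y * Z * (X\<^sup>2 - Y * Z) \<noteq> 0"
proof
  assume "Y * Z * (X\<^sup>2 - Y * Z) = 0"
  then consider "Y = 0" | "Z = 0" | "X\<^sup>2 = Y * Z" by auto
  then show False
  proof cases
    case 3
    have "X * (Y ^ 5 + Z ^ 5 - 2 * X ^ 5) = 0"
      using assms(1) 3 unfolding hc_form_def by algebra
    then have "Y ^ 5 + Z ^ 5 = 2 * X ^ 5" using assms(2) by simp
    then have "(Y ^ 5 - Z ^ 5)\<^sup>2 = 0" using 3 by algebra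
    then have "Y ^ 5 = Z ^ 5" by simp
    then show False using 3 assms(3) by algebra
  qed (use assms in \<open>simp_all add: hc_form_def\<close>)
qed

text \<open>
  The leading coefficient is the value of the sextic form at \<open>(0, 1, 1)\<close>: no line through this
  point is contained in the curve, and none loses an intersection at infinity.
\<close>

lemma hc_pencil:
  obtains p where "degree p \<le> 6" "coeff p 6 = - 2" "\<And>t. poly p t = hc_form X (Y + t) (Z + t)"
proof
  define P Q where "P = [:Y, 1:]" and "Q = [:Z, 1:]"
  let ?p = "smult X (P ^ 5 + Q ^ 5) + (smult X (P * Q)) ^ 2 - smult (X ^ 4) (P * Q) - smult 2 ((P * Q) ^ 3)"
  have deg: "degree P = 1" "degree Q = 1" and lc: "lead_coeff P = 1" "lead_coeff Q = 1"
    by (simp_all add: P_def Q_def)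
  then have PQ: "degree (P * Q) = 2" "lead_coeff (P * Q) = 1"
    by (subst degree_mult_eq lead_coeff_mult; force)+
  have "P \<noteq> 0" "Q \<noteq> 0" by (simp_all add: P_def Q_def)
  then have "degree (P ^ 5) = 5" "degree (Q ^ 5) = 5" "degree ((P * Q) ^ 3) = 6"
    "degree ((smult X (P * Q)) ^ 2) \<le> 4"
    using deg PQ(1) degree_power_le[of "smult X (P * Q)" 2] degree_smult_le[of X "P * Q"]
    by (auto simp: degree_power_eq simp del: degree_mult_eq)
  moreover have "coeff ((P * Q) ^ 3) 6 = 1"
    using lead_coeff_power[of "P * Q" 3] PQ(2) calculation(3) by simp
  ultimately show "coeff ?p 6 = - 2"
    using PQ(1) by (simp add: coeff_eq_0)
  show "degree ?p \<le> 6"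
    by (intro degree_diff_le degree_add_le order.trans[OF degree_smult_le])
      (use \<open>degree (P ^ 5) = 5\<close> \<open>degree (Q ^ 5) = 5\<close> \<open>degree ((P * Q) ^ 3) = 6\<close>
        \<open>degree ((smult X (P * Q)) ^ 2) \<le> 4\<close> PQ(1) in auto)
  show "poly ?p t = hc_form X (Y + t) (Z + t)" for t
    by (simp add: hc_form_def P_def Q_def power_mult_distrib algebra_simps)
qed

text \<open>
  Move \<open>v\<close> slightly so that \<open>X\<close> and \<open>Y - Z\<close> avoid the values excluded in
  \<open>hc_boundary_nonzero\<close>, then return to the curve along the direction \<open>(0, 1, 1)\<close>, which changes
  neither \<open>X\<close> nor \<open>Y - Z\<close>.
\<close>

lemma hc_approx:
  assumes "v \<noteq> 0" "on_hc v"
  shows "\<exists>w::nat \<Rightarrow> complex ^ 3. w \<longlonglongrightarrow> v \<and>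
      (\<forall>\<^sub>F n in sequentially. w n \<noteq> 0 \<and> on_hc (w n) \<and> hc_boundary (w n) \<noteq> 0)"
proof -
  define X Y Z where XYZ: "X = v $ 1" "Y = v $ 2" "Z = v $ 3"
  obtain x where x: "x \<longlonglongrightarrow> X" "\<And>n. x n \<noteq> 0"
    using approx_avoiding_finite[of "\<lambda>_. {0}" X] by auto
  have "finite {M. M ^ 5 + 5 * M ^ 3 * (x n)\<^sup>2 + 5 * M * x n ^ 4 = 0}" for n
  proof -
    have "finite {M. poly [:0, 5 * x n ^ 4, 0, 5 * (x n)\<^sup>2, 0, 1:] M = 0}"
      by (rule poly_roots_finite) simp
    then show ?thesis by (rule back_subst) (auto simp: algebra_simps power_numeral_reduce)
  qed
  then obtain m where m: "m \<longlonglongrightarrow> Y - Z" "\<And>n. m n \<notin> {M. M ^ 5 + 5 * M ^ 3 * (x n)\<^sup>2 + 5 * M * x n ^ 4 = 0}"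
    using approx_avoiding_finite[of "\<lambda>n. {M. M ^ 5 + 5 * M ^ 3 * (x n)\<^sup>2 + 5 * M * x n ^ 4 = 0}" "Y - Z"]
    by blast
  have "\<exists>p. degree p \<le> 6 \<and> coeff p 6 = - 2 \<and> (\<forall>t. poly p t = hc_form (x n) (Z + m n + t) (Z + t))" for n
    using hc_pencil[of "x n" "Z + m n" Z] by metis
  then obtain p where p: "\<And>n. degree (p n) \<le> 6" "\<And>n. coeff (p n) 6 = - 2"
      "\<And>n t. poly (p n) t = hc_form (x n) (Z + m n + t) (Z + t)"
    by metis
  have "(\<lambda>n. hc_form (x n) (Z + m n) Z) \<longlonglongrightarrow> hc_form X (Z + (Y - Z)) Z"
    unfolding hc_form_def by (intro tendsto_intros x m)
  then have p0: "(\<lambda>n. poly (p n) 0) \<longlonglongrightarrow> 0"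
    using assms(2) unfolding p(3) on_hc_def XYZ by simp
  obtain r where r: "r \<longlonglongrightarrow> 0" "\<forall>\<^sub>F n in sequentially. poly (p n) (r n) = 0"
    using roots_tendsto_0[of p 5 "- 2"] p(1,2) p0 by auto
  define w :: "nat \<Rightarrow> complex ^ 3" where "w n = vector [x n, Z + m n + r n, Z + r n]" for n
  have "(\<lambda>n. Z + m n + r n) \<longlonglongrightarrow> Z + (Y - Z) + 0" "(\<lambda>n. Z + r n) \<longlonglongrightarrow> Z + 0"
    by (intro tendsto_intros m r)+
  then have "\<forall>i. (\<lambda>n. w n $ i) \<longlonglongrightarrow> v $ i"
    using x(1) by (simp add: forall_3 w_def XYZ)
  then have "w \<longlonglongrightarrow> v" by (intro vec_tendstoI) blast
  moreover have "\<forall>\<^sub>F n in sequentially. w n \<noteq> 0 \<and> on_hc (w n) \<and> hc_boundary (w n) \<noteq> 0"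
    using r(2)
  proof eventually_elim
    case (elim n)
    then have h: "hc_form (x n) (Z + m n + r n) (Z + r n) = 0" by (simp add: p(3))
    have "hc_boundary (w n) \<noteq> 0"
      using hc_boundary_nonzero[OF h x(2)] m(2)[of n] by (simp add: hc_boundary_def w_def)
    moreover have "w n \<noteq> 0" using x(2)[of n] by (auto simp: w_def vec_eq_iff forall_3)
    ultimately show ?case using h by (simp add: on_hc_def w_def)
  qed
  ultimately show ?thesis by blast
qed

section \<open>Density on Bring's curve\<close>

text \<open>
  The equation of bidegree (3, 3) of Bring's curve on the quadric \<open>a d + b c = 0\<close>, a product of two
  projective lines.
\<close>

definition bring_bidegree :: "complex \<Rightarrow> complex \<Rightarrow> complex \<Rightarrow> complex \<Rightarrow> complex" where
  "bring_bidegree s t u v = s ^ 3 * u * v\<^sup>2 - s\<^sup>2 * t * u ^ 3 - s * t\<^sup>2 * v ^ 3 - t ^ 3 * u\<^sup>2 * v"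

definition quadric_param :: "complex \<Rightarrow> complex \<Rightarrow> complex \<Rightarrow> complex \<Rightarrow> complex ^ 5" where
  "quadric_param s t u v = vec_of_fourier (s * u) (s * v) (- (t * u)) (t * v)"

lemma on_bring_quadric_param:
  "on_bring (quadric_param s t u v) \<longleftrightarrow> bring_bidegree s t u v = 0"
proof -
  have "(s * u)\<^sup>2 * (- (t * u)) - (s * v) * (t * v)\<^sup>2 + (s * u) * (s * v)\<^sup>2 - (- (t * u))\<^sup>2 * (t * v)
    = bring_bidegree s t u v"
    unfolding bring_bidegree_def by algebra
  then show ?thesis
    unfolding quadric_param_def on_bring_vec_of_fourier by simp
qed

lemma on_bring_ruling:
  assumes "on_bring x"
  obtains s t u v where "x = quadric_param s t u v"
proof -
  define a b c d where abcd: "a = coeffA x" "b = coeffB x" "c = coeffC x" "d = coeffD x"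
  have 1: "a * d + b * c = 0" and x: "vec_of_fourier a b c d = x"
    using on_bring_coeffs[OF assms(1)] unfolding abcd by blast+
  consider "a \<noteq> 0" | "a = 0" "b \<noteq> 0" | "a = 0" "b = 0" by blast
  then have "\<exists>s t u v. a = s * u \<and> b = s * v \<and> c = - (t * u) \<and> d = t * v"
  proof cases
    case 1
    then show ?thesis using \<open>a * d + b * c = 0\<close>
      by (intro exI[of _ 1] exI[of _ "- c / a"] exI[of _ a] exI[of _ b])
        (simp add: field_simps eq_neg_iff_add_eq_0)
  next
    case 2
    then show ?thesis using \<open>a * d + b * c = 0\<close>
      by (intro exI[of _ 1] exI[of _ "d / b"] exI[of _ a] exI[of _ b]) auto
  next
    case 3
    then show ?thesis
      by (intro exI[of _ 0] exI[of _ 1] exI[of _ "- c"] exI[of _ d]) auto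
  qed
  then show thesis using that x unfolding quadric_param_def by metis
qed

text \<open>
  Eliminating \<open>\<sigma>\<close> leaves \<open>a ^ 5 = 1\<close>; then \<open>\<tau> = a \<sigma>\<close> satisfies \<open>\<tau>\<^sup>2 = \<tau> + 1\<close> and \<open>\<tau> ^ 5 = \<sigma> ^ 5\<close>,
  and the conclusion is the golden ratio identity \<open>\<tau> ^ 10 = 11 \<tau> ^ 5 + 1\<close>.
\<close>

lemma golden_power:
  fixes \<sigma> a :: complex
  assumes "\<sigma>\<^sup>2 = a ^ 4 * \<sigma> + a ^ 3" "a * \<sigma> ^ 4 - \<sigma> ^ 3 - a ^ 3 * \<sigma> - a\<^sup>2 = 0" "a \<noteq> 0"
  shows "\<sigma> ^ 10 - 11 * \<sigma> ^ 5 - 1 = 0"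
proof -
  \<comment> \<open>The second equation, reduced modulo the first to a polynomial linear in \<open>\<sigma>\<close>.\<close>
  have "a\<^sup>2 * ((a ^ 5 - 1) * (\<sigma> * a * (a ^ 5 + 2) + (a ^ 5 + 1))) = 0"
    using assms(1,2) by algebra
  then have "a ^ 5 = 1 \<or> \<sigma> * a * (a ^ 5 + 2) + (a ^ 5 + 1) = 0" using assms(3) by simp
  moreover have False if "\<sigma> * a * (a ^ 5 + 2) + (a ^ 5 + 1) = 0"
  proof -
    have "a ^ 5 + 1 = - (\<sigma> * a * (a ^ 5 + 2))" using that by algebra
    then have "(a ^ 5 + 1)\<^sup>2 = a ^ 5 * (a ^ 5 + 2)" using assms(1) by algebra
    \<comment> \<open>With \<open>k = a ^ 5\<close> this reads \<open>(k + 1)\<^sup>2 = k (k + 2)\<close>.\<close>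
    then show False by (simp add: power2_eq_square algebra_simps)
  qed
  ultimately have a5: "a ^ 5 = 1" by blast
  define \<tau> where "\<tau> = a * \<sigma>"
  have "\<tau>\<^sup>2 = \<tau> + 1" using a5 assms(1) unfolding \<tau>_def by algebra
  then have "\<tau> ^ 10 - 11 * \<tau> ^ 5 - 1 = 0" by algebra
  moreover have "\<tau> ^ 5 = \<sigma> ^ 5" "\<tau> ^ 10 = \<sigma> ^ 10"
    using a5 unfolding \<tau>_def by algebra+
  ultimately show ?thesis by simp
qed

text \<open>
  The excluded values of \<open>[s : t]\<close> are those of the points removed from Bring's curve. The rulings
  over \<open>0\<close> and \<open>\<infinity>\<close> carry the four points with a vanishing coordinate, which correspond to
  \<open>[1:0:0]\<close>, \<open>[0:1:0]\<close> and \<open>[0:0:1]\<close>. Those over the roots of \<open>\<tau>\<^sup>2 = \<tau> + 1\<close> times fifth roots of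
  unity carry the points over the other five nodes. In the affine coordinates \<open>\<sigma> = s / t\<close> and
  \<open>a = (s u) / (t v)\<close> both equations become those of \<open>golden_power\<close>.
\<close>

lemma bring_boundary_quadric_param_nonzero:
  assumes g: "bring_bidegree s t u v = 0" and nz: "s \<noteq> 0" "t \<noteq> 0" "u \<noteq> 0 \<or> v \<noteq> 0"
    and P: "s ^ 10 - 11 * s ^ 5 * t ^ 5 - t ^ 10 \<noteq> 0"
  shows "bring_boundary (quadric_param s t u v) \<noteq> 0"
proof -
  have uv: "u \<noteq> 0" "v \<noteq> 0"
    using g nz by (auto simp: bring_bidegree_def)
  have "((s * u)\<^sup>2 - (- (t * u)) * (t * v))\<^sup>2 - (s * u * (s * v)) * (s * v * (t * v)) \<noteq> 0"
  proof
    assume "((s * u)\<^sup>2 - (- (t * u)) * (t * v))\<^sup>2 - (s * u * (s * v)) * (s * v * (t * v)) = 0"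
    then have "s * (s ^ 3 * u ^ 4 + s * t\<^sup>2 * u ^ 3 * v - t ^ 3 * v ^ 4) = 0"
      using g unfolding bring_bidegree_def by algebra
    then have q: "s ^ 3 * u ^ 4 + s * t\<^sup>2 * u ^ 3 * v = t ^ 3 * v ^ 4" using nz by simp
    define \<sigma> a where "\<sigma> = s / t" and "a = (s * u) / (t * v)"
    have s: "s = \<sigma> * t" and u: "\<sigma> * u = a * v"
      using nz uv by (auto simp: \<sigma>_def a_def)
    have \<sigma>: "\<sigma> \<noteq> 0" "a \<noteq> 0" using nz uv by (auto simp: \<sigma>_def a_def)
    have "t ^ 3 * v ^ 4 * (\<sigma>\<^sup>2 - (a ^ 4 * \<sigma> + a ^ 3)) = 0"
      using q u unfolding s by algebra
    then have 1: "\<sigma>\<^sup>2 = a ^ 4 * \<sigma> + a ^ 3" using nz uv by simp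
    have "t ^ 3 * v ^ 3 * (a * \<sigma> ^ 4 - \<sigma> ^ 3 - a ^ 3 * \<sigma> - a\<^sup>2) = 0"
      using g u unfolding s bring_bidegree_def by algebra
    then have 2: "a * \<sigma> ^ 4 - \<sigma> ^ 3 - a ^ 3 * \<sigma> - a\<^sup>2 = 0" using nz uv by simp
    have "t ^ 10 * (\<sigma> ^ 10 - 11 * \<sigma> ^ 5 - 1) = 0" using golden_power[OF 1 2 \<sigma>(2)] by simp
    then show False using P unfolding s by algebra
  qed
  then show ?thesis
    using nz uv unfolding quadric_param_def bring_boundary_vec_of_fourier by simp
qed

lemma bring_pencil:
  obtains p where "degree p \<le> 3" "coeff p 3 = bring_bidegree s t e f"
    "\<And>r. poly p r = bring_bidegree s t (u + e * r) (v + f * r)"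
proof
  define P Q where "P = [:u, e:]" and "Q = [:v, f:]"
  let ?p = "smult (s ^ 3) (P * Q\<^sup>2) - smult (s\<^sup>2 * t) (P ^ 3) - smult (s * t\<^sup>2) (Q ^ 3) - smult (t ^ 3) (P\<^sup>2 * Q)"
  show "degree ?p \<le> 3"
    unfolding P_def Q_def
    by (intro degree_le) (auto simp: power2_eq_square power3_eq_cube coeff_pCons split: nat.splits)
  show "coeff ?p 3 = bring_bidegree s t e f"
    by (simp add: P_def Q_def bring_bidegree_def power2_eq_square power3_eq_cube numeral_3_eq_3 algebra_simps)
  show "poly ?p r = bring_bidegree s t (u + e * r) (v + f * r)" for r
    by (simp add: P_def Q_def bring_bidegree_def algebra_simps)
qed

text \<open>
  As for the plane curve, with the rulings \<open>[s : t] = const\<close> of the quadric in place of the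
  lines in a fixed direction: perturb \<open>[s : t]\<close>, then return to the curve by solving a cubic equation on
  the ruling.
\<close>

lemma bring_approx:
  assumes "x \<noteq> 0" "on_bring x"
  shows "\<exists>w::nat \<Rightarrow> complex ^ 5. w \<longlonglongrightarrow> x \<and>
      (\<forall>\<^sub>F n in sequentially. w n \<noteq> 0 \<and> on_bring (w n) \<and> bring_boundary (w n) \<noteq> 0)"
proof -
  obtain s t u v where x: "x = quadric_param s t u v"
    using on_bring_ruling[OF assms(2)] .
  have st: "s \<noteq> 0 \<or> t \<noteq> 0"
    using assms(1) unfolding x by (auto simp: quadric_param_def vec_of_fourier_def vec_eq_iff)
  \<comment> \<open>A direction in which the cubic equation keeps its degree on the ruling through \<open>x\<close>, hence nearby.\<close>
  have "\<exists>e f. bring_bidegree s t e f \<noteq> 0"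
  proof (cases "s = 0 \<or> t = 0")
    case True
    then show ?thesis using st by (intro exI[of _ 1]) (auto simp: bring_bidegree_def)
  next
    case False
    then show ?thesis by (intro exI[of _ 1] exI[of _ 0]) (auto simp: bring_bidegree_def)
  qed
  then obtain e f where ef: "bring_bidegree s t e f \<noteq> 0" by blast
  obtain s' where s': "s' \<longlonglongrightarrow> s" "\<And>n. s' n \<noteq> 0"
    using approx_avoiding_finite[of "\<lambda>_. {0}" s] by auto
  let ?R = "\<lambda>n. {t. t = 0 \<or> s' n ^ 10 - 11 * s' n ^ 5 * t ^ 5 - t ^ 10 = 0}"
  have "finite (?R n)" for n
  proof -
    have "finite {t. poly [:s' n ^ 10, 0, 0, 0, 0, - 11 * s' n ^ 5, 0, 0, 0, 0, - 1:] t = 0}"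
      by (rule poly_roots_finite) simp
    then have "finite (insert 0 {t. poly [:s' n ^ 10, 0, 0, 0, 0, - 11 * s' n ^ 5, 0, 0, 0, 0, - 1:] t = 0})"
      by simp
    then show ?thesis
      by (rule rev_finite_subset) (auto simp: algebra_simps power_numeral_reduce)
  qed
  then obtain t' where t': "t' \<longlonglongrightarrow> t" "\<And>n. t' n \<notin> ?R n"
    using approx_avoiding_finite[of ?R t] by blast
  have "\<exists>p. degree p \<le> 3 \<and> coeff p 3 = bring_bidegree (s' n) (t' n) e f \<and>
      (\<forall>r. poly p r = bring_bidegree (s' n) (t' n) (u + e * r) (v + f * r))" for n
    using bring_pencil[of "s' n" "t' n" e f u v] by metis
  then obtain p where p: "\<And>n. degree (p n) \<le> 3"
      "\<And>n. coeff (p n) 3 = bring_bidegree (s' n) (t' n) e f"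
      "\<And>n r. poly (p n) r = bring_bidegree (s' n) (t' n) (u + e * r) (v + f * r)"
    by metis
  have lim: "(\<lambda>n. bring_bidegree (s' n) (t' n) y z) \<longlonglongrightarrow> bring_bidegree s t y z" for y z
    unfolding bring_bidegree_def by (intro tendsto_intros s' t')
  have lc: "(\<lambda>n. coeff (p n) 3) \<longlonglongrightarrow> bring_bidegree s t e f"
    unfolding p(2) by (rule lim)
  have p0: "(\<lambda>n. poly (p n) 0) \<longlonglongrightarrow> 0"
    using lim[of u v] assms(2) unfolding p(3) x on_bring_quadric_param by simp
  obtain r where r: "r \<longlonglongrightarrow> 0" "\<forall>\<^sub>F n in sequentially. poly (p n) (r n) = 0"
    using roots_tendsto_0[of p 2 "bring_bidegree s t e f"] p(1) lc ef p0 by auto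
  define u' v' where "u' n = u + e * r n" and "v' n = v + f * r n" for n
  have "u' \<longlonglongrightarrow> u + e * 0" "v' \<longlonglongrightarrow> v + f * 0"
    unfolding u'_def v'_def by (intro tendsto_intros r)+
  then have u': "u' \<longlonglongrightarrow> u" and v': "v' \<longlonglongrightarrow> v" by simp_all
  define w where "w n = quadric_param (s' n) (t' n) (u' n) (v' n)" for n
  have "(\<lambda>n. w n $ i) \<longlonglongrightarrow> x $ i" for i
    unfolding w_def x quadric_param_def vec_of_fourier_def vec_lambda_beta
    by (intro tendsto_intros s' t' u' v')
  then have "w \<longlonglongrightarrow> x" by (rule vec_tendstoI)
  moreover have "\<forall>\<^sub>F n in sequentially. w n \<noteq> 0 \<and> on_bring (w n) \<and> bring_boundary (w n) \<noteq> 0"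
    using r(2) tendsto_imp_eventually_ne[OF \<open>w \<longlonglongrightarrow> x\<close> assms(1)]
  proof eventually_elim
    case (elim n)
    then have g: "bring_bidegree (s' n) (t' n) (u' n) (v' n) = 0" by (simp add: p(3) u'_def v'_def)
    have "u' n \<noteq> 0 \<or> v' n \<noteq> 0"
      using elim(2) by (auto simp: w_def quadric_param_def vec_of_fourier_def vec_eq_iff)
    then have "bring_boundary (w n) \<noteq> 0"
      using bring_boundary_quadric_param_nonzero[OF g s'(2)[of n]] t'(2)[of n] by (simp add: w_def)
    then show ?case using g elim(2) by (simp add: w_def on_bring_quadric_param)
  qed
  ultimately show ?thesis by blast
qed

section \<open>The birational equivalence\<close>

theorem proposition2p11: "birationally_equivalent HC_curve Bring_curve"
proof -
  have HC: "HC_curve = {proj_pt v | v. v \<noteq> 0 \<and> on_hc v}"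
    unfolding HC_curve_def on_hc_def hc_form_def Let_def ..
  have Bring: "Bring_curve = {proj_pt x | x. x \<noteq> 0 \<and> on_bring x}"
    unfolding Bring_curve_def on_bring_def ..
  have zero: "bring_boundary 0 = 0" "hc_boundary 0 = 0"
    by (simp_all add: bring_boundary_def hc_boundary_def fourier_coeff_def)
  show ?thesis unfolding HC Bring
  proof (rule birationally_equivalentI[where F = to_bring and G = to_hc
        and H = hc_boundary and K = bring_boundary])
    show "dense_open_in {proj_pt v |v. v \<noteq> 0 \<and> on_hc v}
        {proj_pt v |v. v \<noteq> 0 \<and> on_hc v \<and> hc_boundary v \<noteq> 0}"
      using homogeneous_poly_hc_boundary hc_approx by (rule dense_open_inI)
    show "dense_open_in {proj_pt x |x. x \<noteq> 0 \<and> on_bring x}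
        {proj_pt x |x. x \<noteq> 0 \<and> on_bring x \<and> bring_boundary x \<noteq> 0}"
      using homogeneous_poly_bring_boundary bring_approx by (rule dense_open_inI)
  next
    fix v assume v: "on_hc v" "hc_boundary v \<noteq> 0"
    show "to_bring v \<noteq> 0 \<and> on_bring (to_bring v) \<and> bring_boundary (to_bring v) \<noteq> 0"
      using to_bring_nonzero[OF v] on_bring_to_bring[OF v(1)] zero by auto
    show "\<exists>c. c \<noteq> 0 \<and> to_hc (to_bring v) = c *s v"
      using to_hc_to_bring[of v] on_hc_nonzero[OF v] v(2) unfolding hc_boundary_def
      by (metis mult_eq_0_iff)
  next
    fix x assume x: "on_bring x" "bring_boundary x \<noteq> 0"
    then have b: "coeffB x \<noteq> 0" by (auto simp: bring_boundary_def)
    note inv = to_hc_inverse[OF x(1) b]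
    show "\<exists>c. c \<noteq> 0 \<and> to_bring (to_hc x) = c *s x"
      using inv b x(2) unfolding bring_boundary_def by (metis mult_eq_0_iff)
    have "hc_boundary (to_hc x) \<noteq> 0"
      using x(2) by (auto simp: hc_boundary_def to_hc_def bring_boundary_def)
    then show "to_hc x \<noteq> 0 \<and> on_hc (to_hc x) \<and> hc_boundary (to_hc x) \<noteq> 0"
      using on_hc_to_hc[OF x(1)] zero by auto
  qed (rule homogeneous_poly_to_bring homogeneous_poly_to_hc homogeneous_poly_hc_boundary
      homogeneous_poly_bring_boundary on_hc_scale on_bring_scale; assumption?)+
qed

end
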